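(* For $n\ge1$, there is an involution on the set of free Dyck paths of length $2n$ that reverses the parity of the number of flaw blocks; consequently \[\sum_{i=0}^{n}(-1)^i\frac{2i+1}{2n+1}\binom{2n+1}{n-i}=0.\]
   Context: A free Dyck path of length $2n$ is a lattice path from $(0,0)$ to $(2n,0)$ with $n$ up steps $(1,1)$ and $n$ down steps $(1,-1)$. A flaw block is a maximal segment of the path that starts and ends on the $x$-axis and is otherwise strictly below it; the number of flaw blocks equals the number of down steps from height $0$ to height $-1$. *)

theory Defs
  imports Complex_Main
begin

datatype step = Up | Down

definition free_dyck_paths :: "nat \<Rightarrow> step list set" where
  "free_dyck_paths n =
     {p. length p = 2 * n \<and> count_list p Up = n \<and> count_list p Down = n}"

fun step_rise :: "step \<Rightarrow> int" where
  "step_rise Up = 1"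
| "step_rise Down = -1"

text \<open>The ordinate of the lattice point of \<open>p\<close> with abscissa \<open>k\<close>.\<close>

definition height :: "step list \<Rightarrow> nat \<Rightarrow> int" where
  "height p k = sum_list (map step_rise (take k p))"

text \<open>A segment is given by the abscissas \<open>i < j\<close> of its endpoints. Testing lattice points
  suffices: if all interior ones are below the axis, then so is the rest of the segment, and
  \<open>j = i + 1\<close> is impossible because a step changes the height.\<close>

definition below_segment :: "step list \<Rightarrow> nat \<Rightarrow> nat \<Rightarrow> bool" where
  "below_segment p i j \<longleftrightarrow>
     i < j \<and> j \<le> length p \<and> height p i = 0 \<and> height p j = 0 \<and>
     (\<forall>k. i < k \<and> k < j \<longrightarrow> height p k < 0)"

definition flaw_blocks :: "step list \<Rightarrow> (nat \<times> nat) set" where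
  "flaw_blocks p =
     {(i, j). below_segment p i j \<and>
        (\<forall>i' j'. below_segment p i' j' \<and> i' \<le> i \<and> j \<le> j' \<longrightarrow> i' = i \<and> j' = j)}"

definition num_flaw_blocks :: "step list \<Rightarrow> nat" where
  "num_flaw_blocks p = card (flaw_blocks p)"

lemma height_Suc: "k < length p \<Longrightarrow> height p (Suc k) = height p k + step_rise (p ! k)"
  by (simp add: height_def take_Suc_conv_app_nth)

lemma sum_list_step_rise:
  "sum_list (map step_rise p) = int (count_list p Up) - int (count_list p Down)"
proof (induction p)
  case (Cons s p)
  then show ?case by (cases s) auto
qed simp

lemma height_free_dyck_path_end: "p \<in> free_dyck_paths n \<Longrightarrow> height p (2 * n) = 0"
  by (simp add: free_dyck_paths_def height_def sum_list_step_rise)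

lemma flaw_blocks_eq: "flaw_blocks p = {(i, j). below_segment p i j}"
proof -
  have "i' = i \<and> j' = j"
    if s: "below_segment p i j" and s': "below_segment p i' j'" and le: "i' \<le> i" "j \<le> j'"
    for i j i' j'
  proof -
    have "\<not> (i' < i \<and> i < j')" "\<not> (i' < j \<and> j < j')"
      using s s' unfolding below_segment_def by (metis less_irrefl)+
    moreover have "i < j" using s by (simp add: below_segment_def)
    ultimately show ?thesis using le by linarith
  qed
  then show ?thesis unfolding flaw_blocks_def by blast
qed

lemma num_flaw_blocks_eq:
  assumes "p \<in> free_dyck_paths n"
  shows "num_flaw_blocks p = card {k. k < length p \<and> height p k = 0 \<and> p ! k = Down}"
    (is "_ = card ?D")
proof -
  have inj: "inj_on fst (flaw_blocks p)"
  proof (rule inj_onI)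
    fix x y assume x: "x \<in> flaw_blocks p" and y: "y \<in> flaw_blocks p" and e: "fst x = fst y"
    obtain i j j' where xy: "x = (i, j)" "y = (i, j')" using e by (metis prod.collapse)
    have s: "below_segment p i j" "below_segment p i j'"
      using x y by (auto simp: xy flaw_blocks_eq)
    have "\<not> j < j'" "\<not> j' < j"
      using s unfolding below_segment_def by (metis less_irrefl)+
    then show "x = y" using xy by simp
  qed
  have "fst ` flaw_blocks p = ?D"
  proof (intro equalityI subsetI)
    fix i assume "i \<in> fst ` flaw_blocks p"
    then obtain j where s: "below_segment p i j" unfolding flaw_blocks_eq by force
    then have i: "i < length p" "height p i = 0" by (auto simp: below_segment_def)
    have "height p (Suc i) \<le> 0"
    proof (cases "j = Suc i")
      case False
      then have "Suc i < j" using s by (simp add: below_segment_def)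
      then show ?thesis using s by (auto simp: below_segment_def intro: less_imp_le)
    qed (use s in \<open>simp add: below_segment_def\<close>)
    then have "p ! i = Down" using i height_Suc[of i p] by (cases "p ! i") auto
    then show "i \<in> ?D" using i by simp
  next
    fix i assume "i \<in> ?D"
    then have i: "i < length p" "height p i = 0" "p ! i = Down" by auto
    define j where "j = (LEAST j. i < j \<and> height p j = 0)"
    have e: "i < length p \<and> height p (length p) = 0"
      using i height_free_dyck_path_end[OF assms] assms by (simp add: free_dyck_paths_def)
    have j: "i < j" "height p j = 0" "j \<le> length p"
      using LeastI[of "\<lambda>j. i < j \<and> height p j = 0", OF e]
        Least_le[of "\<lambda>j. i < j \<and> height p j = 0", OF e]
      by (auto simp: j_def)
    have nz: "height p k \<noteq> 0" if "i < k" "k < j" for k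
      using not_less_Least[of k "\<lambda>j. i < j \<and> height p j = 0"] that by (auto simp: j_def)
    have neg: "height p (Suc i + d) < 0" if "Suc i + d < j" for d
      using that
    proof (induction d)
      case 0
      then show ?case using i height_Suc[of i p] by simp
    next
      case (Suc d)
      have "height p (Suc (Suc i + d)) = height p (Suc i + d) + step_rise (p ! (Suc i + d))"
        using Suc.prems j by (intro height_Suc) simp
      moreover have "step_rise (p ! (Suc i + d)) \<le> 1" by (cases "p ! (Suc i + d)") auto
      moreover have "height p (Suc (Suc i + d)) \<noteq> 0" using nz Suc.prems by simp
      ultimately show ?case using Suc by simp
    qed
    have "height p k < 0" if "i < k" "k < j" for k
      using neg[of "k - Suc i"] that by simp
    then have "below_segment p i j" using i j by (simp add: below_segment_def)
    then show "i \<in> fst ` flaw_blocks p" unfolding flaw_blocks_eq by force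
  qed
  then show ?thesis unfolding num_flaw_blocks_def using card_image[OF inj] by simp
qed

end

theory Submission
  imports Defs
begin

text \<open>Reflecting a path in the axis up to its first return changes, among the steps leaving the axis,
  only the first one, so this involution changes the number of descents from the axis by one.

  For the identity, the term with \<open>(-1) ^ i\<close> counts the free Dyck paths with \<open>i\<close> flaw blocks, so the
  alternating sum cancels along the involution. To obtain this count by induction on the length, let
  the walk start at any height \<open>h\<close>: the walks of length \<open>m\<close> from \<open>h\<close> to 0 with exactly \<open>i\<close>
  descents from the axis are as many as the walks of length \<open>m\<close> from \<open>\<bar>h\<bar> + 2i\<close> to 0,
  less those from \<open>\<bar>h\<bar> + 2i + 2\<close> to 0.\<close>

lemma sum_sign_reversing_involution:
  fixes f :: "'a \<Rightarrow> 'b :: linordered_ab_group_add"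
  assumes closed: "\<And>x. x \<in> A \<Longrightarrow> \<phi> x \<in> A"
    and involution: "\<And>x. x \<in> A \<Longrightarrow> \<phi> (\<phi> x) = x"
    and sign_reversing: "\<And>x. x \<in> A \<Longrightarrow> f (\<phi> x) = - f x"
  shows "sum f A = 0"
proof -
  have "sum f A = (\<Sum>x\<in>A. - f x)"
    by (rule sum.reindex_bij_witness[of _ \<phi> \<phi>]) (auto simp: closed involution sign_reversing)
  then show ?thesis by (simp add: sum_negf)
qed

fun axis_descents :: "int \<Rightarrow> step list \<Rightarrow> nat" where
  "axis_descents h [] = 0"
| "axis_descents h (s # p) =
     (if h = 0 \<and> s = Down then 1 else 0) + axis_descents (h + step_rise s) p"

lemma height_0 [simp]: "height p 0 = 0"
  by (simp add: height_def)

lemma height_Cons_Suc [simp]: "height (s # p) (Suc k) = step_rise s + height p k"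
  by (simp add: height_def)

lemma axis_descents_eq_card:
  "axis_descents h p = card {k. k < length p \<and> h + height p k = 0 \<and> p ! k = Down}"
proof (induction p arbitrary: h)
  case (Cons s p)
  define K where "K = {k. k < length p \<and> (h + step_rise s) + height p k = 0 \<and> p ! k = Down}"
  have "finite K" by (simp add: K_def)
  have "{k. k < length (s # p) \<and> h + height (s # p) k = 0 \<and> (s # p) ! k = Down}
      = (if h = 0 \<and> s = Down then {0} else {}) \<union> Suc ` K" (is "?L = ?R")
  proof (rule set_eqI)
    show "k \<in> ?L \<longleftrightarrow> k \<in> ?R" for k by (cases k) (auto simp: K_def)
  qed
  with \<open>finite K\<close> have "card ?L = (if h = 0 \<and> s = Down then 1 else 0) + card K"
    by (simp add: card_image)
  with Cons.IH[of "h + step_rise s"] show ?case by (simp add: K_def)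
qed simp

lemma axis_descents_le: "axis_descents h p \<le> count_list p Down"
  by (induction h p rule: axis_descents.induct) auto

lemma num_flaw_blocks_eq_axis_descents:
  "p \<in> free_dyck_paths n \<Longrightarrow> num_flaw_blocks p = axis_descents 0 p"
  by (simp add: num_flaw_blocks_eq axis_descents_eq_card)

definition walks_to_axis :: "nat \<Rightarrow> int \<Rightarrow> step list set" where
  "walks_to_axis m h = {p. length p = m \<and> h + sum_list (map step_rise p) = 0}"

lemma Nil_mem_walks_to_axis_iff [simp]: "[] \<in> walks_to_axis m h \<longleftrightarrow> m = 0 \<and> h = 0"
  by (auto simp: walks_to_axis_def)

lemma Cons_mem_walks_to_axis_iff [simp]:
  "s # p \<in> walks_to_axis (Suc m) h \<longleftrightarrow> p \<in> walks_to_axis m (h + step_rise s)"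
  by (simp add: walks_to_axis_def add.assoc)

lemma walks_to_axis_0: "walks_to_axis 0 h = (if h = 0 then {[]} else {})"
  by (auto simp: walks_to_axis_def)

lemma count_list_Up_add_Down: "count_list p Up + count_list p Down = length p"
proof (induction p)
  case (Cons s p)
  then show ?case by (cases s) auto
qed simp

lemma free_dyck_paths_eq_walks_to_axis: "free_dyck_paths n = walks_to_axis (2 * n) 0"
proof (rule set_eqI)
  show "p \<in> free_dyck_paths n \<longleftrightarrow> p \<in> walks_to_axis (2 * n) 0" for p
    using count_list_Up_add_Down[of p]
    by (auto simp: free_dyck_paths_def walks_to_axis_def sum_list_step_rise)
qed

lemma walks_to_axis_eq_empty:
  assumes "h < - int m"
  shows "walks_to_axis m h = {}"
proof -
  have "p \<notin> walks_to_axis m h" for p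
    using assms count_list_Up_add_Down[of p] by (auto simp: walks_to_axis_def sum_list_step_rise)
  then show ?thesis by blast
qed

lemma finite_walks_to_axis: "finite (walks_to_axis m h)"
proof (rule finite_subset)
  show "finite {p. set p \<subseteq> {Up, Down} \<and> length p = m}"
    by (rule finite_lists_length_eq) simp
  show "walks_to_axis m h \<subseteq> {p. set p \<subseteq> {Up, Down} \<and> length p = m}"
    using step.exhaust by (auto simp: walks_to_axis_def)
qed

lemma finite_free_dyck_paths: "finite (free_dyck_paths n)"
  by (simp add: free_dyck_paths_eq_walks_to_axis finite_walks_to_axis)

lemma card_walks_to_axis_Suc_filter:
  "card {p \<in> walks_to_axis (Suc m) h. P p}
    = card {p \<in> walks_to_axis m (h + 1). P (Up # p)}
      + card {p \<in> walks_to_axis m (h - 1). P (Down # p)}"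
proof -
  let ?U = "{p \<in> walks_to_axis m (h + 1). P (Up # p)}"
  let ?D = "{p \<in> walks_to_axis m (h - 1). P (Down # p)}"
  have "{p \<in> walks_to_axis (Suc m) h. P p} = Cons Up ` ?U \<union> Cons Down ` ?D" (is "?L = ?R")
  proof (rule set_eqI)
    fix p
    show "p \<in> ?L \<longleftrightarrow> p \<in> ?R"
    proof (cases p)
      case (Cons s q)
      then show ?thesis by (cases s) auto
    qed auto
  qed
  moreover have "card (Cons Up ` ?U \<union> Cons Down ` ?D) = card (Cons Up ` ?U) + card (Cons Down ` ?D)"
    by (rule card_Un_disjoint) (auto simp: finite_walks_to_axis)
  ultimately show ?thesis by (simp add: card_image)
qed

lemma card_walks_to_axis_Suc:
  "card (walks_to_axis (Suc m) h) = card (walks_to_axis m (h + 1)) + card (walks_to_axis m (h - 1))"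
  using card_walks_to_axis_Suc_filter[of m h "\<lambda>_. True"] by simp

lemma card_walks_to_axis_minus: "card (walks_to_axis m (- h)) = card (walks_to_axis m h)"
proof (induction m arbitrary: h)
  case (Suc m)
  show ?case
    using Suc[of "h + 1"] Suc[of "h - 1"] by (simp add: card_walks_to_axis_Suc)
qed (simp add: walks_to_axis_0)

lemma card_walks_to_axis: "card (walks_to_axis m (2 * int k - int m)) = m choose k"
proof (induction m arbitrary: k)
  case 0
  show ?case by (cases k) (simp_all add: walks_to_axis_0)
next
  case (Suc m)
  show ?case
  proof (cases k)
    case 0
    then show ?thesis
      using Suc.IH[of 0] by (simp add: card_walks_to_axis_Suc walks_to_axis_eq_empty)
  next
    case (Suc j)
    then show ?thesis
      using Suc.IH[of j] Suc.IH[of k] by (simp add: card_walks_to_axis_Suc algebra_simps)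
  qed
qed

lemma card_walks_to_axis_axis_descents:
  "int (card {p \<in> walks_to_axis m h. axis_descents h p = i})
    = int (card (walks_to_axis m (\<bar>h\<bar> + 2 * int i)))
      - int (card (walks_to_axis m (\<bar>h\<bar> + 2 * int i + 2)))"
proof (induction m arbitrary: h i)
  case 0
  have "{p \<in> walks_to_axis 0 h. axis_descents h p = i} = (if h = 0 \<and> i = 0 then {[]} else {})"
    by (auto simp: walks_to_axis_0)
  then show ?case by (auto simp: walks_to_axis_0)
next
  case (Suc m)
  note split = card_walks_to_axis_Suc_filter card_walks_to_axis_Suc
  consider (above) "h > 0" | (below) "h < 0" | (axis_0) "h = 0" "i = 0"
    | (axis_Suc) j where "h = 0" "i = Suc j"
    by (cases i) fastforce+
  then show ?case
  proof cases
    case above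
    then show ?thesis using Suc[of "h + 1" i] Suc[of "h - 1" i]
      by (simp add: split algebra_simps)
  next
    case below
    then show ?thesis using Suc[of "h + 1" i] Suc[of "h - 1" i]
      by (simp add: split algebra_simps)
  next
    case axis_0
    then show ?thesis using Suc[of 1 0] card_walks_to_axis_minus[of m 1]
      by (simp add: split)
  next
    case axis_Suc
    then show ?thesis using Suc[of 1 i] Suc[of "- 1" j]
      by (simp add: split algebra_simps)
  qed
qed

lemma binomial_diff_Suc:
  "real (N choose k) - real (N choose Suc k)
    = (2 * real k + 1 - real N) / real (Suc N) * real (Suc N choose Suc k)"
proof -
  have "real (Suc N) * real (N choose k) = real (Suc k) * real (Suc N choose Suc k)"
    using Suc_times_binomial[of k N] by (metis of_nat_mult)
  moreover have "real (Suc N choose Suc k) = real (N choose k) + real (N choose Suc k)"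
    by simp
  ultimately have "real (Suc N) * (real (N choose k) - real (N choose Suc k))
      = (2 * real k + 1 - real N) * real (Suc N choose Suc k)"
    by (simp add: algebra_simps)
  then show ?thesis
    by (simp add: eq_divide_eq mult.commute del: binomial_Suc_Suc)
qed

lemma card_free_dyck_paths_num_flaw_blocks:
  assumes "i \<le> n"
  shows "real (card {p \<in> free_dyck_paths n. num_flaw_blocks p = i})
    = real (2 * i + 1) / real (2 * n + 1) * real ((2 * n + 1) choose (n - i))"
proof -
  have "{p \<in> free_dyck_paths n. num_flaw_blocks p = i}
      = {p \<in> walks_to_axis (2 * n) 0. axis_descents 0 p = i}"
    using num_flaw_blocks_eq_axis_descents by (auto simp: free_dyck_paths_eq_walks_to_axis)
  then have "int (card {p \<in> free_dyck_paths n. num_flaw_blocks p = i})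
      = int (card (walks_to_axis (2 * n) (2 * int i)))
        - int (card (walks_to_axis (2 * n) (2 * int (Suc i))))"
    by (simp add: card_walks_to_axis_axis_descents algebra_simps)
  also have "\<dots> = int (2 * n choose (n + i)) - int (2 * n choose Suc (n + i))"
    using card_walks_to_axis[of "2 * n" "n + i"] card_walks_to_axis[of "2 * n" "Suc (n + i)"]
    by (simp add: algebra_simps)
  finally have "real (card {p \<in> free_dyck_paths n. num_flaw_blocks p = i})
      = real (2 * n choose (n + i)) - real (2 * n choose Suc (n + i))"
    by linarith
  also have "\<dots> = real (2 * i + 1) / real (2 * n + 1) * real ((2 * n + 1) choose Suc (n + i))"
    using binomial_diff_Suc[of "2 * n" "n + i"] by (simp del: binomial_Suc_Suc)
  also have "(2 * n + 1) choose Suc (n + i) = (2 * n + 1) choose (n - i)"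
    using assms by (subst binomial_symmetric) auto
  finally show ?thesis .
qed

lemma num_flaw_blocks_le:
  assumes "p \<in> free_dyck_paths n"
  shows "num_flaw_blocks p \<le> n"
proof -
  have "num_flaw_blocks p \<le> count_list p Down"
    unfolding num_flaw_blocks_eq_axis_descents[OF assms] by (rule axis_descents_le)
  with assms show ?thesis by (simp add: free_dyck_paths_def)
qed

fun flip_step :: "step \<Rightarrow> step" where
  "flip_step Up = Down"
| "flip_step Down = Up"

lemma flip_step_flip_step [simp]: "flip_step (flip_step s) = s"
  by (cases s) auto

lemma step_rise_flip_step [simp]: "step_rise (flip_step s) = - step_rise s"
  by (cases s) auto

fun flip_excursion :: "int \<Rightarrow> step list \<Rightarrow> step list" where
  "flip_excursion h [] = []"
| "flip_excursion h (s # p) =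
     flip_step s # (if h + step_rise s = 0 then p else flip_excursion (h + step_rise s) p)"

lemma flip_excursion_minus_flip_excursion: "flip_excursion (- h) (flip_excursion h p) = p"
proof (induction p arbitrary: h)
  case (Cons s p)
  show ?case using Cons[of "h + step_rise s"] by (auto simp: algebra_simps)
qed simp

lemma flip_excursion_mem_walks_to_axis:
  "p \<in> walks_to_axis m h \<Longrightarrow> flip_excursion h p \<in> walks_to_axis m (- h)"
proof (induction p arbitrary: m h)
  case (Cons s p)
  obtain l where "m = Suc l" using Cons.prems by (cases m) (auto simp: walks_to_axis_def)
  with Cons.prems have p: "p \<in> walks_to_axis l (h + step_rise s)" by simp
  show ?case
  proof (cases "h + step_rise s = 0")
    case True
    then have "step_rise s = - h" by simp
    with p \<open>m = Suc l\<close> show ?thesis by simp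
  next
    case False
    with Cons.IH[OF p] \<open>m = Suc l\<close> show ?thesis by simp
  qed
qed simp

lemma axis_descents_flip_excursion:
  "h \<noteq> 0 \<Longrightarrow> axis_descents (- h) (flip_excursion h p) = axis_descents h p"
proof (induction p arbitrary: h)
  case (Cons s p)
  show ?case
  proof (cases "h + step_rise s = 0")
    case True
    then have "step_rise s = - h" by simp
    with Cons.prems show ?thesis by simp
  next
    case False
    with Cons.IH[of "h + step_rise s"] Cons.prems show ?thesis by simp
  qed
qed simp

lemma even_axis_descents_flip_excursion_0:
  assumes "p \<noteq> []"
  shows "even (axis_descents 0 (flip_excursion 0 p)) \<longleftrightarrow> odd (axis_descents 0 p)"
proof -
  obtain s q where "p = s # q" using assms by (cases p) auto
  then show ?thesis
    using axis_descents_flip_excursion[of "step_rise s" q] by (cases s) auto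
qed

lemma flip_excursion_free_dyck_path:
  "p \<in> free_dyck_paths n \<Longrightarrow> flip_excursion 0 p \<in> free_dyck_paths n"
  using flip_excursion_mem_walks_to_axis[of p "2 * n" 0]
  by (simp add: free_dyck_paths_eq_walks_to_axis)

lemma even_num_flaw_blocks_flip_excursion:
  assumes "p \<in> free_dyck_paths n" "n \<ge> 1"
  shows "even (num_flaw_blocks (flip_excursion 0 p)) \<longleftrightarrow> odd (num_flaw_blocks p)"
proof -
  have "p \<noteq> []" using assms by (auto simp: free_dyck_paths_def)
  with assms show ?thesis
    by (simp add: num_flaw_blocks_eq_axis_descents[of _ n] flip_excursion_free_dyck_path
        even_axis_descents_flip_excursion_0)
qed

theorem theorem4p1:
  fixes n :: nat
  assumes "n \<ge> 1"
  shows "(\<exists>\<phi> :: step list \<Rightarrow> step list.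
            \<forall>p \<in> free_dyck_paths n.
              \<phi> p \<in> free_dyck_paths n \<and> \<phi> (\<phi> p) = p \<and>
              (even (num_flaw_blocks (\<phi> p)) \<longleftrightarrow> odd (num_flaw_blocks p)))
       \<and> (\<Sum>i = 0..n. (-1) ^ i * (real (2 * i + 1) / real (2 * n + 1))
              * real ((2 * n + 1) choose (n - i))) = 0"
proof
  have involution: "flip_excursion 0 (flip_excursion 0 p) = p" for p
    using flip_excursion_minus_flip_excursion[of 0] by simp
  note reflection = flip_excursion_free_dyck_path involution
    even_num_flaw_blocks_flip_excursion[OF _ assms]
  show "\<exists>\<phi>. \<forall>p \<in> free_dyck_paths n. \<phi> p \<in> free_dyck_paths n \<and> \<phi> (\<phi> p) = p \<and>
      (even (num_flaw_blocks (\<phi> p)) \<longleftrightarrow> odd (num_flaw_blocks p))"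
    using reflection by blast
  have "(\<Sum>i = 0..n. (-1) ^ i * (real (2 * i + 1) / real (2 * n + 1))
        * real ((2 * n + 1) choose (n - i)))
      = (\<Sum>i = 0..n. (-1) ^ i * real (card {p \<in> free_dyck_paths n. num_flaw_blocks p = i}))"
    by (simp add: card_free_dyck_paths_num_flaw_blocks mult.assoc)
  also have "\<dots> = (\<Sum>p\<in>free_dyck_paths n. (-1) ^ num_flaw_blocks p)"
    by (subst sum_fun_comp[of _ "{0..n}"])
      (auto simp: finite_free_dyck_paths num_flaw_blocks_le mult.commute)
  also have "\<dots> = 0"
    by (rule sum_sign_reversing_involution[of _ "flip_excursion 0"])
      (use reflection in \<open>auto simp: minus_one_power_iff\<close>)
  finally show "(\<Sum>i = 0..n. (-1) ^ i * (real (2 * i + 1) / real (2 * n + 1))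
      * real ((2 * n + 1) choose (n - i))) = 0" .
qed

end
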